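(* (Individual rationality for users.) Consider the centralized mechanism and induced game $\mathcal{G}$ described in the context. Assume that a user $i$ who chooses not to participate in the mechanism gets $\boldsymbol{x}^i=\boldsymbol{0}$ and pays nothing (so her payoff is $v^i(\boldsymbol{0})$). Then at any Nash equilibrium $m^*$ of $\mathcal{G}$, participating is weakly better than not participating: for every user $i\in\mathcal{N}$, $$u^i(m^* )\ \ge\ v^i(\boldsymbol{0}).$$
   Context: Setting. There are $N\ge 2$ users $\mathcal{N}=\{1,\dots,N\}$ (user indices $i\pm1$ are taken modulo $N$) and $T\ge 1$ time slots. The prices $p_1,\dots,p_T\in\mathbb{R}$ and the peak price $p_0\ge 0$ are fixed. User $i$'s demand vector is $\boldsymbol{x}^i=(x^i_1,\dots,x^i_T)\in\mathbb{R}^T$, and $\boldsymbol{x}=(\boldsymbol{x}^1,\dots,\boldsymbol{x}^N)\in\mathbb{R}^{NT}$. User $i$'s utility is $v^i(\boldsymbol{x}^i)=\sum_{t=1}^T v^i_t(x^i_t)$, where each $v^i_t:\mathbb{R}\to\mathbb{R}$ is twice differentiable and strictly concave. The feasible set $\mathcal{X}=\{\boldsymbol{x}: A\boldsymbol{x}\le\boldsymbol{b}\}$, with $A\in\mathbb{R}^{L\times NT}$ and $\boldsymbol{b}=(b^1,\dots,b^L)\in\mathbb{R}^L_+$, is a (bounded) polytope and is coordinate convex: if $\boldsymbol{x}\in\mathcal{X}$, then setting any components of $\boldsymbol{x}$ to $0$ gives a point of $\mathcal{X}$. Row $l$ of $A$ has entries $a^{i,l}_t$; put $\boldsymbol{a}^{i,l}=[a^{i,l}_1,\dots,a^{i,l}_T]$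 (row vector), so constraint $l$ is $\sum_i\boldsymbol{a}^{i,l}\boldsymbol{x}^i\le b^l$. Let $\mathcal{L}=\{1,\dots,L\}$ and $\mathcal{L}_i=\{l\in\mathcal{L}:\boldsymbol{a}^{i,l}\ne 0\}$. Centralized mechanism. User $i$'s message is $m^i=((y^i_t)_{t},(q^{i,l})_{l\in\mathcal{L}},(s^i_t)_{t},(\beta^i_t)_{t})$ with $y^i_t\in\mathbb{R}$, $q^{i,l}\in\mathbb{R}_+$, $s^i_t\in\mathbb{R}_+$, $\beta^i_t\in\mathbb{R}$; $m=(m^1,\dots,m^N)$. The allocation is $\hat x^i_t(m)=y^i_t$. The radial pricing operator is, for $\tilde{\boldsymbol{s}}\in\mathbb{R}^T_+$, $\tilde{\boldsymbol{y}}\in\mathbb{R}^T$, $$\mathcal{RP}^i_t(\tilde{\boldsymbol{s}},\tilde{\boldsymbol{y}})=\begin{cases}\dfrac{\tilde s_t}{\sum_{t'}\tilde s_{t'}}\,p_0,&\tilde{\boldsymbol{s}}\neq\boldsymbol{0},\\[2mm] \dfrac{p_0\,\mathbf{1}\{t\in\arg\max_{t'}\tilde y_{t'}\}}{\#(\arg\max_{t'}\tilde y_{t'})},&\tilde{\boldsymbol{s}}=\boldsymbol{0}\end{cases}$$ (the same formula for every $i$). Define $s^{-i}_t=\frac1{N-1}\sum_{j\ne i}s^j_t$, $q^{-i,l}=\frac1{N-1}\sum_{j\ne i}q^{j,l}$, $\zeta^{-i}_t=\sum_{j\neq i}y^j_t+\beta^{i-1}_t$, $z^{-i}=\max_t\zeta^{-i}_t$,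 with vectors $\boldsymbol{s}^{-i}=(s^{-i}_t)_t$, $\boldsymbol{\zeta}^{-i}=(\zeta^{-i}_t)_t$. The tax of user $i$ is $$\hat t^i(m)=\sum_{t=1}^T\big(p_t+\mathcal{RP}^i_t(\boldsymbol{s}^{-i},\boldsymbol{\zeta}^{-i})\big)\hat x^i_t(m)+\sum_{l\in\mathcal{L}_i}q^{-i,l}\boldsymbol{a}^{i,l}\hat{\boldsymbol{x}}^i(m)+\sum_{t=1}^T(\beta^i_t-y^{i+1}_t)^2$$ $$+\sum_{l\in\mathcal{L}}\Big[(q^{i,l}-q^{-i,l})^2+q^{i,l}\Big(b^l-\sum_{j\ne i}\boldsymbol{a}^{j,l}\boldsymbol{y}^j-\boldsymbol{a}^{i,l}\boldsymbol{\beta}^{i-1}\Big)\Big]+\sum_{t=1}^T\Big[(s^i_t-s^{-i}_t)^2+s^i_t(z^{-i}-\zeta^{-i}_t)\Big].$$ The induced game $\mathcal{G}$ has players $\mathcal{N}$, strategies $m^i$, and payoffs $u^i(m)=v^i(\hat{\boldsymbol{x}}^i(m))-\hat t^i(m)$. Nash equilibrium (NE) means pure-strategy Nash equilibrium. *)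

theory Defs
  imports "HOL-Analysis.Analysis"
begin

(* Users are the numbers 1, ..., N with N = num_users E. The finite types 't and 'l index the
   time slots and the rows of the constraint system, so T = CARD('t) and L = CARD('l).
   Functions of a user are only ever inspected at users in {1..N}. *)

record ('t, 'l) environment =
  num_users :: nat
  price :: "real ^ 't"
  peak_price :: real
  slot_utility :: "nat \<Rightarrow> 't \<Rightarrow> real \<Rightarrow> real"
  coeff :: "nat \<Rightarrow> 'l \<Rightarrow> real ^ 't"  (* coeff E i l is the block of row l of A belonging to user i *)
  capacity :: "real ^ 'l"

definition users :: "('t::finite, 'l::finite) environment \<Rightarrow> nat set" where
  "users E = {1..num_users E}"

definition next_user :: "('t::finite, 'l::finite) environment \<Rightarrow> nat \<Rightarrow> nat" where
  "next_user E i = (if i = num_users E then 1 else i + 1)"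

definition prev_user :: "('t::finite, 'l::finite) environment \<Rightarrow> nat \<Rightarrow> nat" where
  "prev_user E i = (if i = 1 then num_users E else i - 1)"

definition utility :: "('t::finite, 'l::finite) environment \<Rightarrow> nat \<Rightarrow> real ^ 't \<Rightarrow> real" where
  "utility E i x = (\<Sum>t\<in>UNIV. slot_utility E i t (x $ t))"

definition feasible :: "('t::finite, 'l::finite) environment \<Rightarrow> (nat \<Rightarrow> real ^ 't) set" where
  "feasible E = {x. \<forall>l. (\<Sum>i\<in>users E. coeff E i l \<bullet> x i) \<le> capacity E $ l}"

definition bounded_feasible :: "('t::finite, 'l::finite) environment \<Rightarrow> bool" where
  "bounded_feasible E \<longleftrightarrow> (\<exists>B. \<forall>x\<in>feasible E. L2_set (\<lambda>i. norm (x i)) (users E) \<le> B)"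

definition coordinate_convex :: "('t::finite, 'l::finite) environment \<Rightarrow> bool" where
  "coordinate_convex E \<longleftrightarrow>
     (\<forall>x\<in>feasible E. \<forall>S. (\<lambda>i. \<chi> t. if (i, t) \<in> S then 0 else x i $ t) \<in> feasible E)"

definition twice_differentiable :: "(real \<Rightarrow> real) \<Rightarrow> bool" where
  "twice_differentiable f \<longleftrightarrow>
     (\<forall>x. f differentiable (at x)) \<and> (\<forall>x. deriv f differentiable (at x))"

definition strictly_concave :: "(real \<Rightarrow> real) \<Rightarrow> bool" where
  "strictly_concave f \<longleftrightarrow>
     (\<forall>x y u. x \<noteq> y \<longrightarrow> 0 < u \<longrightarrow> u < 1 \<longrightarrow>
        u * f x + (1 - u) * f y < f (u * x + (1 - u) * y))"

(* The cases T = 0 and L = 0 do not arise: types are nonempty, and a system without rows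
   would have an unbounded feasible set. *)
definition valid_environment :: "('t::finite, 'l::finite) environment \<Rightarrow> bool" where
  "valid_environment E \<longleftrightarrow>
     2 \<le> num_users E \<and>
     0 \<le> peak_price E \<and>
     (\<forall>i\<in>users E. \<forall>t. twice_differentiable (slot_utility E i t) \<and>
                       strictly_concave (slot_utility E i t)) \<and>
     (\<forall>l. 0 \<le> capacity E $ l) \<and>
     bounded_feasible E \<and>
     coordinate_convex E"

record ('t, 'l) message =
  msg_y :: "real ^ 't"
  msg_q :: "real ^ 'l"
  msg_s :: "real ^ 't"
  msg_beta :: "real ^ 't"

definition messages :: "('t::finite, 'l::finite) message set" where
  "messages = {\<mu>. (\<forall>l. 0 \<le> msg_q \<mu> $ l) \<and> (\<forall>t. 0 \<le> msg_s \<mu> $ t)}"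

type_synonym ('t, 'l) profile = "nat \<Rightarrow> ('t, 'l) message"

definition allocation :: "('t::finite, 'l::finite) profile \<Rightarrow> nat \<Rightarrow> real ^ 't" where
  "allocation m i = msg_y (m i)"

definition argmax_slots :: "real ^ 't::finite \<Rightarrow> 't set" where
  "argmax_slots y = {t. is_arg_max (\<lambda>t'. y $ t') (\<lambda>_. True) t}"

definition radial_price :: "real \<Rightarrow> real ^ 't::finite \<Rightarrow> real ^ 't \<Rightarrow> 't \<Rightarrow> real" where
  "radial_price p0 s y t =
     (if s \<noteq> 0 then s $ t / (\<Sum>t'\<in>UNIV. s $ t') * p0
      else p0 * (if t \<in> argmax_slots y then 1 else 0) / real (card (argmax_slots y)))"

definition s_others ::
  "('t::finite, 'l::finite) environment \<Rightarrow> ('t, 'l) profile \<Rightarrow> nat \<Rightarrow> real ^ 't" where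
  "s_others E m i =
     (1 / (real (num_users E) - 1)) *\<^sub>R (\<Sum>j\<in>users E - {i}. msg_s (m j))"

definition q_others ::
  "('t::finite, 'l::finite) environment \<Rightarrow> ('t, 'l) profile \<Rightarrow> nat \<Rightarrow> real ^ 'l" where
  "q_others E m i =
     (1 / (real (num_users E) - 1)) *\<^sub>R (\<Sum>j\<in>users E - {i}. msg_q (m j))"

definition zeta_others ::
  "('t::finite, 'l::finite) environment \<Rightarrow> ('t, 'l) profile \<Rightarrow> nat \<Rightarrow> real ^ 't" where
  "zeta_others E m i = (\<Sum>j\<in>users E - {i}. msg_y (m j)) + msg_beta (m (prev_user E i))"

definition z_others ::
  "('t::finite, 'l::finite) environment \<Rightarrow> ('t, 'l) profile \<Rightarrow> nat \<Rightarrow> real" where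
  "z_others E m i = Max (range (\<lambda>t. zeta_others E m i $ t))"

definition tax ::
  "('t::finite, 'l::finite) environment \<Rightarrow> ('t, 'l) profile \<Rightarrow> nat \<Rightarrow> real" where
  "tax E m i =
     (\<Sum>t\<in>UNIV. (price E $ t
        + radial_price (peak_price E) (s_others E m i) (zeta_others E m i) t)
        * allocation m i $ t)
   + (\<Sum>l | coeff E i l \<noteq> 0. q_others E m i $ l * (coeff E i l \<bullet> allocation m i))
   + (\<Sum>t\<in>UNIV. (msg_beta (m i) $ t - msg_y (m (next_user E i)) $ t)\<^sup>2)
   + (\<Sum>l\<in>UNIV. (msg_q (m i) $ l - q_others E m i $ l)\<^sup>2
        + msg_q (m i) $ l *
          (capacity E $ l
           - (\<Sum>j\<in>users E - {i}. coeff E j l \<bullet> msg_y (m j))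
           - coeff E i l \<bullet> msg_beta (m (prev_user E i))))
   + (\<Sum>t\<in>UNIV. (msg_s (m i) $ t - s_others E m i $ t)\<^sup>2
        + msg_s (m i) $ t * (z_others E m i - zeta_others E m i $ t))"

definition payoff ::
  "('t::finite, 'l::finite) environment \<Rightarrow> ('t, 'l) profile \<Rightarrow> nat \<Rightarrow> real" where
  "payoff E m i = utility E i (allocation m i) - tax E m i"

definition nash_equilibrium ::
  "('t::finite, 'l::finite) environment \<Rightarrow> ('t, 'l) profile \<Rightarrow> bool" where
  "nash_equilibrium E m \<longleftrightarrow>
     (\<forall>i\<in>users E. m i \<in> messages) \<and>
     (\<forall>i\<in>users E. \<forall>\<mu>\<in>messages. payoff E (m(i := \<mu>)) i \<le> payoff E m i)"

definition nonparticipation_payoff ::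
  "('t::finite, 'l::finite) environment \<Rightarrow> nat \<Rightarrow> real" where
  "nonparticipation_payoff E i = utility E i 0"

end

theory Submission
  imports Defs
begin

text \<open>
  At an equilibrium every \<open>\<beta>\<close>-proxy copies the demand it refers to, so the slacks
  multiplying \<open>q\<^sup>i\<close> and \<open>s\<^sup>i\<close> in the tax are the same vector \<open>c\<close> for all users.
  Deviating to the average of the others shows that the squared distance of \<open>q\<^sup>i\<close> to that
  average is at most its difference to the average, paired with \<open>c\<close>; these differences sum to zero
  over the users, hence all \<open>q\<^sup>i\<close> agree, and shrinking \<open>q\<^sup>i\<close> towards zero then shows that the
  penalty is nonpositive. The same holds for \<open>s\<^sup>i\<close>. Since these penalties do not depend on the
  user's own demand, deviating to zero demand alone guarantees the nonparticipation payoff.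
\<close>

text \<open>Common shape of the \<open>q\<close> part and the \<open>s\<close> part of the tax:
  \<open>a\<close> is the mean message of the others, \<open>c\<close> the slack and
  \<open>x\<close> the own message. A general inner product space covers both index types at
  once.\<close>

definition penalty :: "'a::real_inner \<Rightarrow> 'a \<Rightarrow> 'a \<Rightarrow> real" where
  "penalty a c x = (norm (x - a))\<^sup>2 + x \<bullet> c"

definition mean_others :: "nat set \<Rightarrow> (nat \<Rightarrow> 'a::real_vector) \<Rightarrow> nat \<Rightarrow> 'a" where
  "mean_others I r i = (1 / (real (card I) - 1)) *\<^sub>R (\<Sum>j\<in>I - {i}. r j)"

text \<open>Each \<open>r j\<close> enters the means of the other \<open>card I - 1\<close> users
  with weight \<open>1 / (card I - 1)\<close>, so it counts once in total.\<close>

lemma sum_mean_others: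
  fixes r :: "nat \<Rightarrow> 'a::real_vector"
  assumes "finite I" "2 \<le> card I"
  shows "(\<Sum>i\<in>I. mean_others I r i) = sum r I"
proof -
  have n: "real (card I) - 1 \<noteq> 0" using assms by linarith
  have "(\<Sum>i\<in>I. \<Sum>j\<in>I - {i}. r j) = (\<Sum>i\<in>I. sum r I - r i)"
    using assms by (intro sum.cong) (auto simp: sum_diff1)
  also have "\<dots> = (real (card I) - 1) *\<^sub>R sum r I"
    by (simp add: sum_subtractf sum_constant_scaleR scaleR_left_diff_distrib)
  finally show ?thesis
    using n by (simp add: mean_others_def flip: scaleR_sum_right)
qed

text \<open>\<open>K\<close> stands for the nonnegative orthant; the deviations used are the mean of
  the others and a scaled copy of the own vector. That \<open>c\<close> is the same for all users
  makes the linear terms cancel when summed.\<close>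

lemma penalty_best_response_nonpos:
  fixes r :: "nat \<Rightarrow> 'a::real_inner"
  assumes fin: "finite I" and card: "2 \<le> card I"
    and mean: "\<And>i. i \<in> I \<Longrightarrow> mean_others I r i \<in> K"
    and scale: "\<And>i u. i \<in> I \<Longrightarrow> 0 \<le> u \<Longrightarrow> u *\<^sub>R r i \<in> K"
    and best: "\<And>i x. i \<in> I \<Longrightarrow> x \<in> K \<Longrightarrow>
      penalty (mean_others I r i) c (r i) \<le> penalty (mean_others I r i) c x"
    and i: "i \<in> I"
  shows "penalty (mean_others I r i) c (r i) \<le> 0"
proof -
  let ?a = "mean_others I r"
  have le: "(norm (r j - ?a j))\<^sup>2 \<le> (?a j - r j) \<bullet> c" if "j \<in> I" for j
    using best[OF that mean[OF that]] by (simp add: penalty_def inner_diff_left)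
  have "(\<Sum>j\<in>I. (norm (r j - ?a j))\<^sup>2) \<le> (\<Sum>j\<in>I. (?a j - r j) \<bullet> c)"
    by (rule sum_mono) (rule le)
  also have "\<dots> = 0"
    by (simp add: sum_subtractf sum_mean_others[OF fin card] flip: inner_sum_left)
  finally have "(\<Sum>j\<in>I. (norm (r j - ?a j))\<^sup>2) = 0"
    by (intro antisym sum_nonneg) auto
  then have eq: "?a i = r i"
    using fin i by (simp add: sum_nonneg_eq_0_iff)
  \<comment> \<open>Shrinking \<open>r i\<close> by the factor \<open>1 - e\<close> saves
    \<open>e * (r i \<bullet> c)\<close>, of first order in \<open>e\<close>, while the quadratic
    cost is of second order. Dividing by \<open>e\<close> and letting \<open>e\<close> tend to 0
    leaves the sign of the linear term.\<close>
  have bound: "r i \<bullet> c \<le> e * (norm (r i))\<^sup>2" if e: "0 < e" "e \<le> 1" for e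
  proof -
    have "penalty (r i) c (r i) \<le> penalty (r i) c ((1 - e) *\<^sub>R r i)"
      using best[OF i scale[OF i, of "1 - e"]] e by (simp add: eq)
    moreover have "(1 - e) *\<^sub>R r i - r i = - e *\<^sub>R r i"
      by (simp add: algebra_simps)
    ultimately have "e * (r i \<bullet> c) \<le> e * (e * (norm (r i))\<^sup>2)"
      by (simp add: penalty_def power_mult_distrib algebra_simps power2_eq_square)
    with e show ?thesis by simp
  qed
  have "((\<lambda>e. e * (norm (r i))\<^sup>2) \<longlongrightarrow> 0 * (norm (r i))\<^sup>2) (at_right 0)"
    by (intro tendsto_intros)
  moreover have "eventually (\<lambda>e. r i \<bullet> c \<le> e * (norm (r i))\<^sup>2) (at_right 0)"
    by (rule eventually_mono[OF eventually_at_right_real[of 0 1]]) (auto intro: bound)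
  ultimately have "r i \<bullet> c \<le> 0 * (norm (r i))\<^sup>2"
    by (rule tendsto_lowerbound) simp
  then show ?thesis by (simp add: eq penalty_def)
qed

text \<open>The part of the tax driven by the user's own demand. Its unit prices come from the
  others' messages, so \<open>y\<close> is a separate argument that a deviation can change
  alone.\<close>

definition usage_charge ::
  "('t::finite, 'l::finite) environment \<Rightarrow> ('t, 'l) profile \<Rightarrow> nat \<Rightarrow> real ^ 't \<Rightarrow> real" where
  "usage_charge E m i y =
     (\<Sum>t\<in>UNIV. (price E $ t
        + radial_price (peak_price E) (s_others E m i) (zeta_others E m i) t) * y $ t)
   + (\<Sum>l | coeff E i l \<noteq> 0. q_others E m i $ l * (coeff E i l \<bullet> y))"

definition capacity_slack ::
  "('t::finite, 'l::finite) environment \<Rightarrow> ('t, 'l) profile \<Rightarrow> nat \<Rightarrow> real ^ 'l" where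
  "capacity_slack E m i = (\<chi> l. capacity E $ l
     - (\<Sum>j\<in>users E - {i}. coeff E j l \<bullet> msg_y (m j))
     - coeff E i l \<bullet> msg_beta (m (prev_user E i)))"

definition peak_slack ::
  "('t::finite, 'l::finite) environment \<Rightarrow> ('t, 'l) profile \<Rightarrow> nat \<Rightarrow> real ^ 't" where
  "peak_slack E m i = (\<chi> t. z_others E m i - zeta_others E m i $ t)"

lemma usage_charge_0 [simp]: "usage_charge E m i 0 = 0"
  by (simp add: usage_charge_def)

lemma power2_norm_vec: "(norm (x :: real ^ 'n))\<^sup>2 = (\<Sum>t\<in>UNIV. (x $ t)\<^sup>2)"
  by (simp add: norm_vec_def L2_set_def sum_nonneg)

text \<open>Separates the tax by the components of the own message: \<open>y\<close>,
  \<open>beta\<close>, \<open>q\<close> and \<open>s\<close> each govern one summand.\<close>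

lemma tax_eq:
  "tax E m i = usage_charge E m i (msg_y (m i))
     + (norm (msg_beta (m i) - msg_y (m (next_user E i))))\<^sup>2
     + penalty (q_others E m i) (capacity_slack E m i) (msg_q (m i))
     + penalty (s_others E m i) (peak_slack E m i) (msg_s (m i))"
  by (simp add: tax_def usage_charge_def penalty_def power2_norm_vec inner_vec_def
      capacity_slack_def peak_slack_def allocation_def sum.distrib)

text \<open>With at least two users nobody is her own neighbour on the cycle, so what is read from a
  neighbour stays fixed when a user deviates.\<close>

lemma neighbour_users:
  assumes "2 \<le> num_users E" "i \<in> users E"
  shows "next_user E i \<noteq> i" "prev_user E i \<noteq> i" "prev_user E i \<in> users E"
    "next_user E (prev_user E i) = i"
  using assms by (auto simp: users_def next_user_def prev_user_def)

lemma others_update [simp]: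
  "s_others E (m(i := \<mu>)) i = s_others E m i"
  "q_others E (m(i := \<mu>)) i = q_others E m i"
  by (simp_all add: s_others_def q_others_def)

lemma payoff_update:
  assumes "2 \<le> num_users E" "i \<in> users E"
  shows "payoff E (m(i := \<mu>)) i = utility E i (msg_y \<mu>) - (usage_charge E m i (msg_y \<mu>)
     + (norm (msg_beta \<mu> - msg_y (m (next_user E i))))\<^sup>2
     + penalty (q_others E m i) (capacity_slack E m i) (msg_q \<mu>)
     + penalty (s_others E m i) (peak_slack E m i) (msg_s \<mu>))"
proof -
  have zeta: "zeta_others E (m(i := \<mu>)) i = zeta_others E m i"
    using neighbour_users[OF assms] by (simp add: zeta_others_def)
  have "usage_charge E (m(i := \<mu>)) i = usage_charge E m i"
    by (simp add: usage_charge_def zeta fun_eq_iff)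
  moreover have "capacity_slack E (m(i := \<mu>)) i = capacity_slack E m i"
    using neighbour_users[OF assms] by (simp add: capacity_slack_def)
  moreover have "peak_slack E (m(i := \<mu>)) i = peak_slack E m i"
    by (simp add: peak_slack_def z_others_def zeta)
  ultimately show ?thesis
    using neighbour_users[OF assms] by (simp add: payoff_def tax_eq allocation_def)
qed

lemma s_others_eq: "s_others E m i = mean_others (users E) (\<lambda>j. msg_s (m j)) i"
  and q_others_eq: "q_others E m i = mean_others (users E) (\<lambda>j. msg_q (m j)) i"
  by (simp_all add: s_others_def q_others_def mean_others_def users_def)

lemma nash_equilibrium_beta:
  assumes "2 \<le> num_users E" "nash_equilibrium E m" "i \<in> users E"
  shows "msg_beta (m i) = msg_y (m (next_user E i))"
proof -
  let ?\<mu> = "(m i)\<lparr>msg_beta := msg_y (m (next_user E i))\<rparr>"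
  have "?\<mu> \<in> messages"
    using assms by (auto simp: nash_equilibrium_def messages_def)
  \<comment> \<open>The trivial update on the right lets \<open>payoff_update\<close> rewrite both
    sides; everything but the \<open>beta\<close> term then cancels.\<close>
  then have "payoff E (m(i := ?\<mu>)) i \<le> payoff E (m(i := m i)) i"
    using assms by (auto simp: nash_equilibrium_def)
  then show ?thesis
    unfolding payoff_update[OF assms(1,3)] by simp
qed

lemma nash_equilibrium_beta_prev:
  assumes "2 \<le> num_users E" "nash_equilibrium E m" "i \<in> users E"
  shows "msg_beta (m (prev_user E i)) = msg_y (m i)"
  using nash_equilibrium_beta[OF assms(1,2)] neighbour_users[OF assms(1,3)] by simp

text \<open>The predecessor's proxy supplies the summand missing from the sum over the others, so
  only totals over all users remain and \<open>i\<close> drops out.\<close>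

lemma nash_equilibrium_slack:
  assumes "2 \<le> num_users E" "nash_equilibrium E m" "i \<in> users E"
  shows "capacity_slack E m i =
      (\<chi> l. capacity E $ l - (\<Sum>j\<in>users E. coeff E j l \<bullet> msg_y (m j)))"
    and "peak_slack E m i =
      (\<chi> t. Max (range (\<lambda>t'. (\<Sum>j\<in>users E. msg_y (m j)) $ t')) - (\<Sum>j\<in>users E. msg_y (m j)) $ t)"
proof -
  have fin: "finite (users E)" by (simp add: users_def)
  note beta = nash_equilibrium_beta_prev[OF assms]
  show "capacity_slack E m i =
      (\<chi> l. capacity E $ l - (\<Sum>j\<in>users E. coeff E j l \<bullet> msg_y (m j)))"
    by (simp add: capacity_slack_def beta sum.remove[OF fin assms(3)] algebra_simps)
  have "zeta_others E m i = (\<Sum>j\<in>users E. msg_y (m j))"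
    by (simp add: zeta_others_def beta sum.remove[OF fin assms(3)] add.commute)
  then show "peak_slack E m i =
      (\<chi> t. Max (range (\<lambda>t'. (\<Sum>j\<in>users E. msg_y (m j)) $ t')) - (\<Sum>j\<in>users E. msg_y (m j)) $ t)"
    by (simp add: peak_slack_def z_others_def)
qed

lemma mean_others_nonneg:
  fixes r :: "nat \<Rightarrow> real ^ 'n"
  assumes "2 \<le> card I" "\<And>j t. j \<in> I \<Longrightarrow> 0 \<le> r j $ t"
  shows "0 \<le> mean_others I r i $ t"
  using assms by (auto simp: mean_others_def intro!: divide_nonneg_nonneg sum_nonneg)

lemma nash_equilibrium_penalty_nonpos:
  fixes E :: "('t::finite, 'l::finite) environment"
  assumes N: "2 \<le> num_users E" and ne: "nash_equilibrium E m" and i: "i \<in> users E"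
  shows "penalty (q_others E m i) (capacity_slack E m i) (msg_q (m i)) \<le> 0"
    and "penalty (s_others E m i) (peak_slack E m i) (msg_s (m i)) \<le> 0"
proof -
  have fin: "finite (users E)" and card: "2 \<le> card (users E)"
    using N by (simp_all add: users_def)
  have nonneg: "0 \<le> msg_q (m j) $ l" "0 \<le> msg_s (m j) $ t" if "j \<in> users E" for j l t
    using ne that by (auto simp: nash_equilibrium_def messages_def)
  have dev: "payoff E (m(j := \<mu>)) j \<le> payoff E (m(j := m j)) j"
    if "j \<in> users E" "\<mu> \<in> messages" for j \<mu>
    using ne that by (auto simp: nash_equilibrium_def)
  \<comment> \<open>Changing only \<open>msg_q\<close> leaves the other summands of the payoff
    alone, so equilibrium play minimises this penalty by itself.\<close>
  have best_q: "penalty (q_others E m j) (capacity_slack E m j) (msg_q (m j))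
      \<le> penalty (q_others E m j) (capacity_slack E m j) x"
    if j: "j \<in> users E" and x: "x \<in> {x. \<forall>l. 0 \<le> x $ l}" for j x
    using dev[OF j, of "(m j)\<lparr>msg_q := x\<rparr>"] nonneg[OF j] x
    unfolding payoff_update[OF N j] by (simp add: messages_def)
  have best_s: "penalty (s_others E m j) (peak_slack E m j) (msg_s (m j))
      \<le> penalty (s_others E m j) (peak_slack E m j) x"
    if j: "j \<in> users E" and x: "x \<in> {x. \<forall>t. 0 \<le> x $ t}" for j x
    using dev[OF j, of "(m j)\<lparr>msg_s := x\<rparr>"] nonneg[OF j] x
    unfolding payoff_update[OF N j] by (simp add: messages_def)
  \<comment> \<open>The slacks of the fixed user \<open>i\<close> serve as the common vector
    \<open>c\<close>.\<close>
  have slack: "capacity_slack E m j = capacity_slack E m i" "peak_slack E m j = peak_slack E m i"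
    if "j \<in> users E" for j
    using nash_equilibrium_slack[OF N ne] that i by simp_all
  show "penalty (q_others E m i) (capacity_slack E m i) (msg_q (m i)) \<le> 0"
    unfolding q_others_eq
  proof (rule penalty_best_response_nonpos[OF fin card, where K = "{x. \<forall>l. 0 \<le> x $ l}"])
    fix j and x :: "real ^ 'l"
    assume j: "j \<in> users E" and x: "x \<in> {x. \<forall>l. 0 \<le> x $ l}"
    show "penalty (mean_others (users E) (\<lambda>j. msg_q (m j)) j) (capacity_slack E m i) (msg_q (m j))
        \<le> penalty (mean_others (users E) (\<lambda>j. msg_q (m j)) j) (capacity_slack E m i) x"
      using best_q[OF j x] by (simp only: slack[OF j] q_others_eq)
  next
    fix j assume "j \<in> users E"
    show "mean_others (users E) (\<lambda>j. msg_q (m j)) j \<in> {x. \<forall>l. 0 \<le> x $ l}"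
      using mean_others_nonneg[OF card nonneg(1)] by simp
  next
    fix j and u :: real assume "j \<in> users E" "0 \<le> u"
    then show "u *\<^sub>R msg_q (m j) \<in> {x. \<forall>l. 0 \<le> x $ l}"
      using nonneg by simp
  qed (rule i)
  show "penalty (s_others E m i) (peak_slack E m i) (msg_s (m i)) \<le> 0"
    unfolding s_others_eq
  proof (rule penalty_best_response_nonpos[OF fin card, where K = "{x. \<forall>t. 0 \<le> x $ t}"])
    fix j and x :: "real ^ 't"
    assume j: "j \<in> users E" and x: "x \<in> {x. \<forall>t. 0 \<le> x $ t}"
    show "penalty (mean_others (users E) (\<lambda>j. msg_s (m j)) j) (peak_slack E m i) (msg_s (m j))
        \<le> penalty (mean_others (users E) (\<lambda>j. msg_s (m j)) j) (peak_slack E m i) x"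
      using best_s[OF j x] by (simp only: slack[OF j] s_others_eq)
  next
    fix j assume "j \<in> users E"
    show "mean_others (users E) (\<lambda>j. msg_s (m j)) j \<in> {x. \<forall>t. 0 \<le> x $ t}"
      using mean_others_nonneg[OF card nonneg(2)] by simp
  next
    fix j and u :: real assume "j \<in> users E" "0 \<le> u"
    then show "u *\<^sub>R msg_s (m j) \<in> {x. \<forall>t. 0 \<le> x $ t}"
      using nonneg by simp
  qed (rule i)
qed

theorem theorem3:
  fixes E :: "('t::finite, 'l::finite) environment" and m :: "('t, 'l) profile"
  assumes "valid_environment E"
    and "nash_equilibrium E m"
  shows "\<forall>i\<in>users E. payoff E m i \<ge> nonparticipation_payoff E i"
proof
  fix i assume i: "i \<in> users E"
  have N: "2 \<le> num_users E" using assms(1) by (simp add: valid_environment_def)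
  \<comment> \<open>Keeping the equilibrium \<open>beta\<close>, \<open>q\<close> and
    \<open>s\<close> makes the proxy term vanish and retains the two nonpositive penalties, while
    zero demand removes the usage charge.\<close>
  let ?\<mu> = "(m i)\<lparr>msg_y := 0\<rparr>"
  have "?\<mu> \<in> messages"
    using assms(2) i by (auto simp: nash_equilibrium_def messages_def)
  then have "payoff E (m(i := ?\<mu>)) i \<le> payoff E m i"
    using assms(2) i by (auto simp: nash_equilibrium_def)
  moreover have "nonparticipation_payoff E i \<le> payoff E (m(i := ?\<mu>)) i"
    using nash_equilibrium_penalty_nonpos[OF N assms(2) i]
    unfolding payoff_update[OF N i]
    by (simp add: nonparticipation_payoff_def nash_equilibrium_beta[OF N assms(2) i])
  ultimately show "payoff E m i \<ge> nonparticipation_payoff E i" by simp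
qed

end
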